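(* Let $n\ge1$ be an integer. Then $$\sum_{\sigma\in\mathfrak{D}_n}\beta^{\mathrm{cyc}\,\sigma}t^{\mathrm{exc}\,\sigma}=\sum_{k=0}^{\lfloor n/2\rfloor}c_{n,k}(\beta)\,t^{k}(1+t)^{n-2k}.$$
   Context: Let $\mathfrak{D}_n$ be the set of derangements of $[n]=\{1,\dots,n\}$ (permutations $\sigma$ with $\sigma(i)\neq i$ for all $i$). For a permutation $\sigma$ of $[n]$, $\mathrm{cyc}\,\sigma$ is the number of its cycles and $\mathrm{exc}\,\sigma=\#\{i\in[n]: i<\sigma(i)\}$. An element $x\in[n]$ is a cyclic valley of $\sigma$ if $\sigma^{-1}(x)>x<\sigma(x)$, and a cyclic double descent (double drop) if $\sigma^{-1}(x)>x>\sigma(x)$. Let $\mathfrak{D}_n(k)$ be the set of derangements in $\mathfrak{D}_n$ with exactly $k$ cyclic valleys and without cyclic double descents, and define $$c_{n,k}(\beta)=\sum_{\sigma\in\mathfrak{D}_n(k)}\beta^{\mathrm{cyc}\,\sigma}.$$ *)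

theory Defs
  imports "HOL-Combinatorics.Combinatorics"
begin

definition derangements :: "nat \<Rightarrow> (nat \<Rightarrow> nat) set" where
  "derangements n = {\<sigma>. \<sigma> permutes {1..n} \<and> (\<forall>i\<in>{1..n}. \<sigma> i \<noteq> i)}"

text \<open>
  Cycles are identified with their underlying sets, the orbits. As \<^term>\<open>\<sigma>\<close> is the identity
  outside \<^term>\<open>{1..n}\<close>, only orbits of points of \<^term>\<open>{1..n}\<close> are counted.
\<close>

definition cyc :: "nat \<Rightarrow> (nat \<Rightarrow> nat) \<Rightarrow> nat" where
  "cyc n \<sigma> = card (orbit \<sigma> ` {1..n})"

definition exc :: "nat \<Rightarrow> (nat \<Rightarrow> nat) \<Rightarrow> nat" where
  "exc n \<sigma> = card {i \<in> {1..n}. i < \<sigma> i}"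

definition cyclic_valley :: "(nat \<Rightarrow> nat) \<Rightarrow> nat \<Rightarrow> bool" where
  "cyclic_valley \<sigma> x \<longleftrightarrow> inv \<sigma> x > x \<and> x < \<sigma> x"

definition cyclic_double_descent :: "(nat \<Rightarrow> nat) \<Rightarrow> nat \<Rightarrow> bool" where
  "cyclic_double_descent \<sigma> x \<longleftrightarrow> inv \<sigma> x > x \<and> x > \<sigma> x"

definition valley_derangements :: "nat \<Rightarrow> nat \<Rightarrow> (nat \<Rightarrow> nat) set" where
  "valley_derangements n k =
     {\<sigma> \<in> derangements n. card {x \<in> {1..n}. cyclic_valley \<sigma> x} = k
        \<and> (\<forall>x\<in>{1..n}. \<not> cyclic_double_descent \<sigma> x)}"

definition c_coeff :: "nat \<Rightarrow> nat \<Rightarrow> 'a::comm_ring_1 \<Rightarrow> 'a" where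
  "c_coeff n k \<beta> = (\<Sum>\<sigma>\<in>valley_derangements n k. \<beta> ^ cyc n \<sigma>)"

end

theory Submission
  imports Defs
begin

text \<open>
  Weight every derangement by its cycles and by the cyclic type (valley, peak, double ascent, double
  descent) of each point. A derangement in which \<open>x\<close> is a double ascent arises from a derangement of
  the remaining points by inserting \<open>x\<close> into an arc that jumps over \<open>x\<close> upwards, one in which \<open>x\<close> is
  a double descent by inserting \<open>x\<close> into an arc that jumps over it downwards. The insertion changes
  neither the number of cycles nor the type of any other point, and as many arcs jump over \<open>x\<close>
  upwards as downwards. Hence the total weight depends on the weights \<open>a\<close> of a double ascent and
  \<open>b\<close> of a double descent at \<open>x\<close> only through \<open>a + b\<close>, so that, one point at a time, the weights
  \<open>(t, 1)\<close> can be replaced by \<open>(1 + t, 0)\<close>.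
\<close>

section \<open>Cycles under insertion of a point\<close>

text \<open>Any ground set is allowed, since the argument passes to \<open>S - {x}\<close>.\<close>

definition derangements_on :: "'a set \<Rightarrow> ('a \<Rightarrow> 'a) set" where
  "derangements_on S = {\<sigma>. \<sigma> permutes S \<and> (\<forall>i\<in>S. \<sigma> i \<noteq> i)}"

lemma finite_derangements_on: "finite S \<Longrightarrow> finite (derangements_on S)"
  unfolding derangements_on_def by (rule finite_subset[OF _ finite_permutations]) auto

text \<open>Composing with \<open>transpose x y\<close> replaces the arc from \<open>y\<close> to
  \<open>\<rho> y\<close> by the two arcs through \<open>x\<close>, and keeps all others. A walk
  along the new cycle is thus the old walk with a detour through \<open>x\<close> after each visit
  to \<open>y\<close>.\<close>

lemma orbit_insert_fixpoint:
  assumes perm: "permutation \<rho>" and fix_x: "\<rho> x = x" and "y \<noteq> x" "u \<noteq> x"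
  shows "orbit (\<rho> \<circ> transpose x y) u - {x} = orbit \<rho> u"
proof -
  let ?\<sigma> = "\<rho> \<circ> transpose x y"
  have inj: "inj \<rho>"
    using perm permutation_bijective bij_is_inj by blast
  have \<sigma>_simps: "?\<sigma> y = x" "?\<sigma> x = \<rho> y" "\<And>v. v \<noteq> x \<Longrightarrow> v \<noteq> y \<Longrightarrow> ?\<sigma> v = \<rho> v"
    using fix_x by auto
  have avoid: "\<rho> v \<noteq> x" if "v \<noteq> x" for v
    using that fix_x inj by (metis injD)
  have sup: "v \<noteq> x \<and> v \<in> orbit ?\<sigma> u" if "v \<in> orbit \<rho> u" for v
    using that
  proof induction
    case base
    show ?case
      using \<open>u \<noteq> x\<close> avoid[of u] \<sigma>_simps orbit.base[of ?\<sigma> u] orbit.step[of x ?\<sigma> u]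
      by (cases "u = y") (simp_all add: comp_def)
  next
    case (step v)
    then show ?case
      using avoid[of v] \<sigma>_simps orbit.step[of v ?\<sigma> u] orbit.step[of x ?\<sigma> u]
      by (cases "v = y") (simp_all add: comp_def)
  qed
  \<comment> \<open>The second disjunct remembers that \<open>x\<close> is only entered from
    \<open>y\<close>, so that the next step, to \<open>\<rho> y\<close>, stays in the old
    orbit.\<close>
  have sub: "v \<noteq> x \<and> v \<in> orbit \<rho> u \<or> v = x \<and> y \<in> orbit \<rho> u" if "v \<in> orbit ?\<sigma> u" for v
    using that
  proof induction
    case base
    show ?case
      using \<open>u \<noteq> x\<close> avoid[of u] \<sigma>_simps permutation_self_in_orbit[OF perm, of u]
        orbit.base[of \<rho> u]
      by (cases "u = y") simp_all
  next
    case (step v)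
    then show ?case
      using \<open>y \<noteq> x\<close> avoid[of v] avoid[of y] \<sigma>_simps orbit.step[of v \<rho> u] orbit.step[of y \<rho> u]
      by (cases "v = x"; cases "v = y") auto
  qed
  show ?thesis
  proof (intro equalityI subsetI)
    show "v \<in> orbit \<rho> u" if "v \<in> orbit ?\<sigma> u - {x}" for v
      using that sub[of v] by simp
    show "v \<in> orbit ?\<sigma> u - {x}" if "v \<in> orbit \<rho> u" for v
      using sup[OF that] by simp
  qed
qed

lemma card_orbits_insert_fixpoint:
  assumes "finite S" "x \<in> S" "y \<in> S" "y \<noteq> x" and \<rho>: "\<rho> permutes S - {x}"
  shows "card (orbit (\<rho> \<circ> transpose x y) ` S) = card (orbit \<rho> ` (S - {x}))"
proof -
  let ?\<sigma> = "\<rho> \<circ> transpose x y"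
  have "?\<sigma> permutes S"
    using assms by (intro permutes_compose permutes_swap_id permutes_subset[OF \<rho>]) auto
  then have perm: "permutation ?\<sigma>" "permutation \<rho>"
    using assms(1) \<rho> by (auto simp: permutation_permutes)
  have fix_x: "\<rho> x = x"
    using \<rho> by (simp add: permutes_not_in)
  have orbit_minus: "orbit ?\<sigma> u - {x} = orbit \<rho> u" if "u \<in> S - {x}" for u
    using orbit_insert_fixpoint[OF perm(2) fix_x \<open>y \<noteq> x\<close>] that by blast
  \<comment> \<open>Since \<open>x\<close> shares its orbit with \<open>y\<close>, it contributes no
    new cycle. It remains to see that deleting \<open>x\<close> from the orbits merges none of
    them.\<close>
  have "orbit ?\<sigma> x = orbit ?\<sigma> y"
    using permutation_orbit_step[OF perm(1), of y] fix_x by simp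
  then have "orbit ?\<sigma> ` S = orbit ?\<sigma> ` (S - {x})"
    using assms(2-4) by (auto simp: image_iff)
  moreover have "(\<lambda>C. C - {x}) ` orbit ?\<sigma> ` (S - {x}) = orbit \<rho> ` (S - {x})"
    unfolding image_image using orbit_minus by (rule image_cong[OF refl])
  moreover have "inj_on (\<lambda>C. C - {x}) (orbit ?\<sigma> ` (S - {x}))"
  proof (rule inj_onI, elim imageE)
    fix C C' u v
    assume C: "C - {x} = C' - {x}" "C = orbit ?\<sigma> u" "C' = orbit ?\<sigma> v" "u \<in> S - {x}"
    \<comment> \<open>The point \<open>u\<close> differs from \<open>x\<close>, so it survives the
      deletion and witnesses that the two orbits meet.\<close>
    have "u \<in> orbit ?\<sigma> u"
      by (rule permutation_self_in_orbit[OF perm(1)])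
    with C have "u \<in> orbit ?\<sigma> v"
      by blast
    then show "C = C'"
      using C orbit_cyclic_eq3[OF cyclic_on_orbit'[OF perm(1)]] by metis
  qed
  ultimately show ?thesis
    by (metis card_image)
qed

section \<open>Inserting a point into an arc that jumps over it\<close>

text \<open>As many points of \<open>T\<close> are mapped below \<open>x\<close> as lie below
  \<open>x\<close>. Cancelling the points that do both leaves the downward crossings on one side and
  the upward ones on the other.\<close>

lemma card_crossings_up_eq_down:
  fixes \<rho> :: "'a::linorder \<Rightarrow> 'a"
  assumes "finite T" "x \<notin> T" "\<rho> permutes T"
  shows "card {y \<in> T. y < x \<and> x < \<rho> y} = card {y \<in> T. x < y \<and> \<rho> y < x}"
proof -
  have ne: "y \<noteq> x" "\<rho> y \<noteq> x" if "y \<in> T" for y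
    using that assms permutes_in_image by metis+
  have "bij_betw \<rho> {y \<in> T. \<rho> y < x} {y \<in> T. y < x}"
    using bij_betw_subset[OF permutes_imp_bij[OF assms(3)]] permutes_in_image[OF assms(3)]
      permutes_image[OF assms(3)]
    by (intro bij_betw_imageI) (auto simp: permutes_inj_on[OF assms(3)])
  then have "card {y \<in> T. \<rho> y < x} = card {y \<in> T. y < x}"
    by (rule bij_betw_same_card)
  moreover have "{y \<in> T. \<rho> y < x} = {y \<in> T. y < x \<and> \<rho> y < x} \<union> {y \<in> T. x < y \<and> \<rho> y < x}"
    using ne by auto (metis neqE)
  moreover have "{y \<in> T. y < x} = {y \<in> T. y < x \<and> \<rho> y < x} \<union> {y \<in> T. y < x \<and> x < \<rho> y}"
    using ne by auto (metis neqE)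
  moreover have "card ({y \<in> T. y < x \<and> \<rho> y < x} \<union> {y \<in> T. x < y \<and> \<rho> y < x})
      = card {y \<in> T. y < x \<and> \<rho> y < x} + card {y \<in> T. x < y \<and> \<rho> y < x}"
    by (rule card_Un_disjoint) (use assms(1) in auto)
  moreover have "card ({y \<in> T. y < x \<and> \<rho> y < x} \<union> {y \<in> T. y < x \<and> x < \<rho> y})
      = card {y \<in> T. y < x \<and> \<rho> y < x} + card {y \<in> T. y < x \<and> x < \<rho> y}"
    by (rule card_Un_disjoint) (use assms(1) in auto)
  ultimately show ?thesis
    by simp
qed

text \<open>
  The two arguments of \<open>W u\<close> tell whether the image and the preimage of \<open>u\<close> exceed \<open>u\<close>; they encode
  the cyclic type of \<open>u\<close>.
\<close>

definition type_weight ::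
  "('a::linorder \<Rightarrow> bool \<Rightarrow> bool \<Rightarrow> 'b::comm_monoid_mult) \<Rightarrow> 'a set \<Rightarrow> ('a \<Rightarrow> 'a) \<Rightarrow> 'b" where
  "type_weight W T \<sigma> = (\<Prod>u\<in>T. W u (u < \<sigma> u) (u < inv \<sigma> u))"

text \<open>Splicing \<open>x\<close> out and recording its preimage \<open>y\<close> is a bijection
  onto pairs of a derangement \<open>\<rho>\<close> of \<open>S - {x}\<close> and the start of an
  arc satisfying \<open>R\<close>. The abstract \<open>R\<close> serves upward and downward
  crossings alike. The weight at \<open>x\<close> is left out, because \<open>\<rho>\<close> does
  not see \<open>x\<close>.\<close>

lemma sum_derangements_on_remove:
  fixes W :: "'a::linorder \<Rightarrow> bool \<Rightarrow> bool \<Rightarrow> 'b::comm_semiring_1"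
  assumes "finite S" "x \<in> S"
    and R: "\<And>y z. R y z \<Longrightarrow> y < x \<and> x < z \<or> z < x \<and> x < y"
  shows "(\<Sum>\<sigma> \<in> {\<sigma> \<in> derangements_on S. R (inv \<sigma> x) (\<sigma> x)}.
            \<beta> ^ card (orbit \<sigma> ` S) * type_weight W (S - {x}) \<sigma>)
       = (\<Sum>\<rho> \<in> derangements_on (S - {x}).
            of_nat (card {y \<in> S - {x}. R y (\<rho> y)}) *
            (\<beta> ^ card (orbit \<rho> ` (S - {x})) * type_weight W (S - {x}) \<rho>))"
    (is "sum ?f ?A = (\<Sum>\<rho>\<in>?B. of_nat (card (?C \<rho>)) * ?g \<rho>)")
proof -
  have insert: "\<rho> \<circ> transpose x y \<in> ?A" "inv (\<rho> \<circ> transpose x y) x = y"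
      "?f (\<rho> \<circ> transpose x y) = ?g \<rho>"
    if \<rho>: "\<rho> \<in> ?B" and y: "y \<in> ?C \<rho>" for \<rho> y
  proof -
    let ?\<sigma> = "\<rho> \<circ> transpose x y"
    have p: "\<rho> permutes S - {x}" and der: "\<And>i. i \<in> S - {x} \<Longrightarrow> \<rho> i \<noteq> i"
      using \<rho> by (auto simp: derangements_on_def)
    have yS: "y \<in> S" "y \<noteq> x" and Ry: "R y (\<rho> y)"
      using y by auto
    have fix_x: "\<rho> x = x" "inv \<rho> x = x"
      using p permutes_inv[OF p] by (auto simp: permutes_not_in)
    have inv\<rho>: "\<rho> (inv \<rho> u) = u" "inv \<rho> (\<rho> u) = u" for u
      using permutes_inverses[OF p] by auto
    have ps: "?\<sigma> permutes S"
      using assms yS by (intro permutes_compose permutes_swap_id permutes_subset[OF p]) auto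
    have inv\<sigma>: "inv ?\<sigma> = transpose x y \<circ> inv \<rho>"
      by (rule inv_unique_comp) (auto simp: fun_eq_iff inv\<rho>)
    show inv_x: "inv ?\<sigma> x = y"
      by (simp add: inv\<sigma> fix_x)
    have "?\<sigma> i \<noteq> i" if "i \<in> S" for i
      using that der[of i] yS fix_x R[OF Ry] by (auto simp: transpose_def)
    with ps inv_x Ry show "?\<sigma> \<in> ?A"
      by (auto simp: derangements_on_def)
    have "type_weight W (S - {x}) ?\<sigma> = type_weight W (S - {x}) \<rho>"
      unfolding type_weight_def
    proof (rule prod.cong[OF refl])
      fix u assume u: "u \<in> S - {x}"
      \<comment> \<open>Only \<open>y\<close> gets a new image, \<open>x\<close> in place of
        \<open>\<rho> y\<close>, and both lie on the same side of \<open>y\<close>.\<close>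
      have "u < ?\<sigma> u \<longleftrightarrow> u < \<rho> u"
        using u fix_x R[OF Ry] by (auto simp: transpose_def)
      moreover have "u < inv ?\<sigma> u \<longleftrightarrow> u < inv \<rho> u"
      \<comment> \<open>Only \<open>\<rho> y\<close> gets a new preimage, \<open>x\<close> in place
        of \<open>y\<close>, again on the same side.\<close>
      proof (cases "inv \<rho> u = y")
        case True
        then have "u = \<rho> y"
          using inv\<rho> by metis
        then show ?thesis
          using R[OF Ry] True by (auto simp: inv\<sigma>)
      next
        case False
        moreover have "inv \<rho> u \<noteq> x"
          using u fix_x inv\<rho> by (metis DiffD2 singletonI)
        ultimately show ?thesis
          by (simp add: inv\<sigma>)
      qed
      ultimately show "W u (u < ?\<sigma> u) (u < inv ?\<sigma> u) = W u (u < \<rho> u) (u < inv \<rho> u)"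
        by simp
    qed
    then show "?f ?\<sigma> = ?g \<rho>"
      using card_orbits_insert_fixpoint[OF assms(1,2) yS p] by simp
  qed
  have remove: "\<sigma> \<circ> transpose x (inv \<sigma> x) \<in> ?B" "inv \<sigma> x \<in> ?C (\<sigma> \<circ> transpose x (inv \<sigma> x))"
    if \<sigma>: "\<sigma> \<in> ?A" for \<sigma>
  proof -
    let ?y = "inv \<sigma> x" and ?\<rho> = "\<sigma> \<circ> transpose x (inv \<sigma> x)"
    have p: "\<sigma> permutes S" and der: "\<And>i. i \<in> S \<Longrightarrow> \<sigma> i \<noteq> i" and Rx: "R ?y (\<sigma> x)"
      using \<sigma> by (auto simp: derangements_on_def)
    have y: "?y \<in> S" "\<sigma> ?y = x"
      using permutes_inverses[OF p] permutes_in_image[OF permutes_inv[OF p]] \<open>x \<in> S\<close> by auto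
    have "?\<rho> permutes S"
      using assms y by (intro permutes_compose permutes_swap_id p) auto
    then have "?\<rho> permutes S - {x}"
      by (rule permutes_superset) (use y in auto)
    \<comment> \<open>The critical point is \<open>?y\<close>, now mapped to
      \<open>\<sigma> x\<close>. These two lie on opposite sides of \<open>x\<close>, so splicing
      out \<open>x\<close> leaves no fixed point.\<close>
    moreover have "?\<rho> i \<noteq> i" if "i \<in> S - {x}" for i
      using that der[of i] R[OF Rx] by (auto simp: transpose_def)
    ultimately show "?\<rho> \<in> ?B"
      by (auto simp: derangements_on_def)
    show "?y \<in> ?C ?\<rho>"
      using y Rx R[OF Rx] by auto
  qed
  have inverse: "\<rho> \<circ> transpose x y \<circ> transpose x y = \<rho>" for \<rho> :: "'a \<Rightarrow> 'a" and y
    by (simp add: comp_assoc)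
  have weight: "?g (\<sigma> \<circ> transpose x (inv \<sigma> x)) = ?f \<sigma>" if "\<sigma> \<in> ?A" for \<sigma>
    using insert(3)[OF remove[OF that]] by (simp only: inverse)
  have "sum ?f ?A = (\<Sum>(\<rho>, y) \<in> Sigma ?B ?C. ?g \<rho>)"
    by (rule sum.reindex_bij_witness[where
          i = "\<lambda>(\<rho>, y). \<rho> \<circ> transpose x y" and
          j = "\<lambda>\<sigma>. (\<sigma> \<circ> transpose x (inv \<sigma> x), inv \<sigma> x)"])
      (use insert remove inverse weight in auto)
  also have "\<dots> = (\<Sum>\<rho>\<in>?B. \<Sum>y\<in>?C \<rho>. ?g \<rho>)"
    using assms(1) by (intro sum.Sigma[symmetric] finite_derangements_on) auto
  finally show ?thesis
    by simp
qed

text \<open>Removing \<open>x\<close> turns both sides into sums over the same derangements of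
  \<open>S - {x}\<close>, with upward and downward crossings of \<open>x\<close> as
  multiplicities.\<close>

lemma sum_double_ascent_eq_double_descent:
  fixes W :: "'a::linorder \<Rightarrow> bool \<Rightarrow> bool \<Rightarrow> 'b::comm_semiring_1"
  assumes "finite S" "x \<in> S"
  shows "(\<Sum>\<sigma> \<in> {\<sigma> \<in> derangements_on S. inv \<sigma> x < x \<and> x < \<sigma> x}.
            \<beta> ^ card (orbit \<sigma> ` S) * type_weight W (S - {x}) \<sigma>)
       = (\<Sum>\<sigma> \<in> {\<sigma> \<in> derangements_on S. x < inv \<sigma> x \<and> \<sigma> x < x}.
            \<beta> ^ card (orbit \<sigma> ` S) * type_weight W (S - {x}) \<sigma>)"
proof -
  have "card {y \<in> S - {x}. y < x \<and> x < \<rho> y} = card {y \<in> S - {x}. x < y \<and> \<rho> y < x}"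
    if "\<rho> \<in> derangements_on (S - {x})" for \<rho>
    using that assms(1) by (intro card_crossings_up_eq_down) (auto simp: derangements_on_def)
  then show ?thesis
    by (subst (1 2) sum_derangements_on_remove[OF assms]) auto
qed

section \<open>Switching weights from \<open>(t, 1)\<close> to \<open>(1 + t, 0)\<close>\<close>

text \<open>\<open>X\<close> holds the points already switched. Valleys always weigh
  \<open>t\<close> and peaks \<open>1\<close>; only double ascents and double descents depend on
  \<open>X\<close>.\<close>

definition exc_weight :: "'a set \<Rightarrow> 'b::comm_ring_1 \<Rightarrow> 'a \<Rightarrow> bool \<Rightarrow> bool \<Rightarrow> 'b" where
  "exc_weight X t u up pre_up =
     (if up = pre_up then (if up then t else 1)
      else if u \<in> X then (if up then 1 + t else 0)
      else (if up then t else 1))"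

lemma sum_exc_weight_insert:
  fixes \<beta> t :: "'b::comm_ring_1" and x :: "'a::linorder"
  assumes "finite S" "x \<in> S" "x \<notin> X"
  shows "(\<Sum>\<sigma>\<in>derangements_on S. \<beta> ^ card (orbit \<sigma> ` S) * type_weight (exc_weight (insert x X) t) S \<sigma>)
       = (\<Sum>\<sigma>\<in>derangements_on S. \<beta> ^ card (orbit \<sigma> ` S) * type_weight (exc_weight X t) S \<sigma>)"
proof -
  let ?D = "derangements_on S"
  let ?h = "\<lambda>\<sigma>. \<beta> ^ card (orbit \<sigma> ` S) * type_weight (exc_weight X t) (S - {x}) \<sigma>"
  let ?A = "{\<sigma> \<in> ?D. inv \<sigma> x < x \<and> x < \<sigma> x}"
  let ?B = "{\<sigma> \<in> ?D. x < inv \<sigma> x \<and> \<sigma> x < x}"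
  \<comment> \<open>Derangements with a valley or a peak at \<open>x\<close>, where switching
    \<open>x\<close> changes nothing.\<close>
  let ?E = "{\<sigma> \<in> ?D. x < inv \<sigma> x \<longleftrightarrow> x < \<sigma> x}"
  have ne: "\<sigma> x \<noteq> x" "inv \<sigma> x \<noteq> x" if "\<sigma> \<in> ?D" for \<sigma>
  proof -
    have "\<sigma> permutes S" and *: "\<sigma> x \<noteq> x"
      using that assms(2) by (auto simp: derangements_on_def)
    with permutes_inverses(1)[of \<sigma> S x] show "\<sigma> x \<noteq> x" "inv \<sigma> x \<noteq> x"
      by auto
  qed
  have split: "sum F ?D = sum F ?E + (sum F ?A + sum F ?B)" for F :: "_ \<Rightarrow> 'b"
  proof -
    have "?D = ?E \<union> (?A \<union> ?B)"
      using ne by (auto simp: not_less) (metis order.not_eq_order_implies_strict)+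
    then have "sum F ?D = sum F (?E \<union> (?A \<union> ?B))"
      by simp
    also have "\<dots> = sum F ?E + sum F (?A \<union> ?B)"
      by (rule sum.union_disjoint) (use finite_derangements_on[OF assms(1)] in auto)
    also have "sum F (?A \<union> ?B) = sum F ?A + sum F ?B"
      by (rule sum.union_disjoint) (use finite_derangements_on[OF assms(1)] in auto)
    finally show ?thesis .
  qed
  \<comment> \<open>\<open>Y\<close> stands for either \<open>X\<close> or
    \<open>insert x X\<close>, so one computation covers both sides.\<close>
  have weight: "type_weight (exc_weight Y t) S \<sigma> =
      exc_weight Y t x (x < \<sigma> x) (x < inv \<sigma> x) * type_weight (exc_weight X t) (S - {x}) \<sigma>"
    if "Y - {x} = X" for Y \<sigma>
  proof -
    have "exc_weight Y t u = exc_weight X t u" if "u \<in> S - {x}" for u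
    proof -
      have "u \<in> Y \<longleftrightarrow> u \<in> X"
        using that \<open>Y - {x} = X\<close> by blast
      then show ?thesis
        by (simp add: exc_weight_def fun_eq_iff)
    qed
    then have "type_weight (exc_weight Y t) (S - {x}) \<sigma> = type_weight (exc_weight X t) (S - {x}) \<sigma>"
      unfolding type_weight_def by (intro prod.cong) simp_all
    then show ?thesis
      unfolding type_weight_def using assms(1,2) by (simp add: prod.remove)
  qed
  have A: "(\<Sum>\<sigma>\<in>?A. \<beta> ^ card (orbit \<sigma> ` S) * type_weight (exc_weight Y t) S \<sigma>)
      = (if x \<in> Y then 1 + t else t) * sum ?h ?A" if "Y - {x} = X" for Y
    unfolding sum_distrib_left weight[OF that]
    by (rule sum.cong) (auto simp: exc_weight_def mult.left_commute elim: less_asym)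
  have B: "(\<Sum>\<sigma>\<in>?B. \<beta> ^ card (orbit \<sigma> ` S) * type_weight (exc_weight Y t) S \<sigma>)
      = (if x \<in> Y then 0 else 1) * sum ?h ?B" if "Y - {x} = X" for Y
    unfolding sum_distrib_left weight[OF that]
    by (rule sum.cong) (auto simp: exc_weight_def elim: less_asym)
  have E: "(\<Sum>\<sigma>\<in>?E. \<beta> ^ card (orbit \<sigma> ` S) * type_weight (exc_weight Y t) S \<sigma>)
      = (\<Sum>\<sigma>\<in>?E. \<beta> ^ card (orbit \<sigma> ` S) * ((if x < \<sigma> x then t else 1) *
          type_weight (exc_weight X t) (S - {x}) \<sigma>))" if "Y - {x} = X" for Y
    unfolding weight[OF that] by (rule sum.cong) (simp_all add: exc_weight_def)
  have "insert x X - {x} = X" "X - {x} = X"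
    using assms(3) by auto
  \<comment> \<open>With \<open>a\<close> and \<open>b\<close> the sums of \<open>?h\<close> over
    \<open>?A\<close> and \<open>?B\<close>, this is
    \<open>(1 + t) * a + 0 * b = t * a + 1 * b\<close>, which holds as \<open>a = b\<close>.\<close>
  then show ?thesis
    using sum_double_ascent_eq_double_descent[OF assms(1,2), of \<beta> "exc_weight X t"] assms(3)
    by (simp add: split E A B distrib_right)
qed

lemma sum_exc_weight:
  fixes \<beta> t :: "'b::comm_ring_1" and S :: "'a::linorder set"
  assumes "finite S"
  shows "(\<Sum>\<sigma>\<in>derangements_on S. \<beta> ^ card (orbit \<sigma> ` S) * type_weight (exc_weight S t) S \<sigma>)
       = (\<Sum>\<sigma>\<in>derangements_on S. \<beta> ^ card (orbit \<sigma> ` S) * type_weight (exc_weight {} t) S \<sigma>)"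
proof -
  have "X \<subseteq> S \<Longrightarrow>
      (\<Sum>\<sigma>\<in>derangements_on S. \<beta> ^ card (orbit \<sigma> ` S) * type_weight (exc_weight X t) S \<sigma>)
    = (\<Sum>\<sigma>\<in>derangements_on S. \<beta> ^ card (orbit \<sigma> ` S) * type_weight (exc_weight {} t) S \<sigma>)"
    if "finite X" for X
    using that by induction (simp_all add: sum_exc_weight_insert assms)
  then show ?thesis
    using assms by blast
qed

section \<open>Evaluating the two extreme weights\<close>

lemma type_weight_exc_weight_empty:
  assumes "finite S"
  shows "type_weight (exc_weight {} t) S \<sigma> = t ^ card {u \<in> S. u < \<sigma> u}"
proof -
  have "type_weight (exc_weight {} t) S \<sigma> = (\<Prod>u\<in>S. if u < \<sigma> u then t else 1)"
    unfolding type_weight_def by (intro prod.cong) (auto simp: exc_weight_def)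
  then show ?thesis
    using assms by (simp flip: prod.inter_filter)
qed

text \<open>Without double descents, the points mapped downwards are as many as the valleys. All
  other points are valleys or double ascents.\<close>

lemma card_double_ascents:
  fixes \<sigma> :: "'a::linorder \<Rightarrow> 'a"
  assumes "finite S" "\<sigma> \<in> derangements_on S"
    and no_ddes: "\<forall>x\<in>S. \<not> (x < inv \<sigma> x \<and> \<sigma> x < x)"
  shows "card {x \<in> S. x < inv \<sigma> x \<and> x < \<sigma> x} * 2 + card {x \<in> S. x < \<sigma> x \<and> \<not> x < inv \<sigma> x} = card S"
proof -
  have p: "\<sigma> permutes S" and der: "\<And>i. i \<in> S \<Longrightarrow> \<sigma> i \<noteq> i"
    using assms(2) by (auto simp: derangements_on_def)
  let ?V = "{x \<in> S. x < inv \<sigma> x \<and> x < \<sigma> x}" and ?A = "{x \<in> S. x < \<sigma> x \<and> \<not> x < inv \<sigma> x}"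
  \<comment> \<open>Each downward arc is counted once by its start and once by its end.\<close>
  have "bij_betw \<sigma> {x \<in> S. \<sigma> x < x} {x \<in> S. x < inv \<sigma> x}"
    by (rule bij_betw_byWitness[where f' = "inv \<sigma>"])
      (use permutes_inverses[OF p] permutes_in_image[OF p] permutes_in_image[OF permutes_inv[OF p]]
        in auto)
  then have "card {x \<in> S. \<sigma> x < x} = card {x \<in> S. x < inv \<sigma> x}"
    by (rule bij_betw_same_card)
  also have "{x \<in> S. x < inv \<sigma> x} = ?V"
    using no_ddes der by (metis neqE)
  finally have "card {x \<in> S. \<sigma> x < x} = card ?V" .
  moreover have "card S = card {x \<in> S. \<sigma> x < x} + (card ?V + card ?A)"
  proof -
    have "S = {x \<in> S. \<sigma> x < x} \<union> (?V \<union> ?A)"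
      using der by (blast elim: neqE)
    then have "card S = card ({x \<in> S. \<sigma> x < x} \<union> (?V \<union> ?A))"
      by (rule arg_cong)
    also have "\<dots> = card {x \<in> S. \<sigma> x < x} + card (?V \<union> ?A)"
      by (rule card_Un_disjoint) (use assms(1) in auto)
    also have "card (?V \<union> ?A) = card ?V + card ?A"
      by (rule card_Un_disjoint) (use assms(1) in auto)
    finally show ?thesis .
  qed
  ultimately show ?thesis
    by simp
qed

text \<open>A single double descent contributes the factor \<open>0\<close>. Otherwise each valley
  gives \<open>t\<close>, each double ascent \<open>1 + t\<close> and each peak
  \<open>1\<close>.\<close>

lemma type_weight_exc_weight_full:
  fixes \<sigma> :: "'a::linorder \<Rightarrow> 'a"
  assumes "finite S" "\<sigma> \<in> derangements_on S"
  shows "type_weight (exc_weight S t) S \<sigma> =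
    (if \<forall>x\<in>S. \<not> (x < inv \<sigma> x \<and> \<sigma> x < x)
     then t ^ card {x \<in> S. x < inv \<sigma> x \<and> x < \<sigma> x} *
       (1 + t) ^ (card S - 2 * card {x \<in> S. x < inv \<sigma> x \<and> x < \<sigma> x})
     else 0)"
proof (cases "\<forall>x\<in>S. \<not> (x < inv \<sigma> x \<and> \<sigma> x < x)")
  case True
  have der: "\<And>i. i \<in> S \<Longrightarrow> \<sigma> i \<noteq> i"
    using assms(2) by (auto simp: derangements_on_def)
  let ?V = "{x \<in> S. x < inv \<sigma> x \<and> x < \<sigma> x}" and ?A = "{x \<in> S. x < \<sigma> x \<and> \<not> x < inv \<sigma> x}"
  have "exc_weight S t u (u < \<sigma> u) (u < inv \<sigma> u) =
      (if u < inv \<sigma> u \<and> u < \<sigma> u then t else 1) * (if u < \<sigma> u \<and> \<not> u < inv \<sigma> u then 1 + t else 1)"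
    if "u \<in> S" for u
    using that True der[OF that] by (auto simp: exc_weight_def)
  then have "type_weight (exc_weight S t) S \<sigma> =
      (\<Prod>u\<in>S. if u < inv \<sigma> u \<and> u < \<sigma> u then t else 1) *
      (\<Prod>u\<in>S. if u < \<sigma> u \<and> \<not> u < inv \<sigma> u then 1 + t else 1)"
    unfolding type_weight_def by (simp flip: prod.distrib)
  also have "\<dots> = t ^ card ?V * (1 + t) ^ card ?A"
    using assms(1) by (simp flip: prod.inter_filter)
  \<comment> \<open>The subtraction is exact, since twice the valleys plus the double ascents make
    up \<open>S\<close>.\<close>
  also have "card ?A = card S - 2 * card ?V"
    using card_double_ascents[OF assms True] by simp
  finally show ?thesis
    using True by simp
next
  case False
  then obtain x where x: "x \<in> S" "x < inv \<sigma> x" "\<sigma> x < x"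
    by blast
  then have "exc_weight S t x (x < \<sigma> x) (x < inv \<sigma> x) = 0"
    by (auto simp: exc_weight_def)
  then have "type_weight (exc_weight S t) S \<sigma> = 0"
    unfolding type_weight_def using assms(1) x(1) by (intro prod_zero) auto
  then show ?thesis
    by (simp only: False if_False)
qed

section \<open>Grouping the derangements by their number of valleys\<close>

theorem theorem11:
  fixes n :: nat and \<beta> t :: "'a::comm_ring_1"
  assumes "n \<ge> 1"
  shows "(\<Sum>\<sigma>\<in>derangements n. \<beta> ^ cyc n \<sigma> * t ^ exc n \<sigma>)
       = (\<Sum>k = 0..n div 2. c_coeff n k \<beta> * t ^ k * (1 + t) ^ (n - 2 * k))"
proof -
  let ?S = "{1..n}"
  let ?D = "derangements_on ?S"
  define V where "V \<sigma> = card {x \<in> ?S. x < inv \<sigma> x \<and> x < \<sigma> x}" for \<sigma> :: "nat \<Rightarrow> nat"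
  define N where "N = {\<sigma> \<in> ?D. \<forall>x\<in>?S. \<not> (x < inv \<sigma> x \<and> \<sigma> x < x)}"
  let ?f = "\<lambda>\<sigma>. \<beta> ^ cyc n \<sigma> * (t ^ V \<sigma> * (1 + t) ^ (n - 2 * V \<sigma>))"
  have D: "derangements n = ?D"
    by (simp add: derangements_def derangements_on_def)
  have finD: "finite ?D"
    by (simp add: finite_derangements_on)
  have val: "valley_derangements n k = {\<sigma> \<in> N. V \<sigma> = k}" for k
    by (auto simp: valley_derangements_def D N_def V_def cyclic_valley_def
        cyclic_double_descent_def)
  have "(\<Sum>\<sigma>\<in>derangements n. \<beta> ^ cyc n \<sigma> * t ^ exc n \<sigma>)
      = (\<Sum>\<sigma>\<in>?D. \<beta> ^ card (orbit \<sigma> ` ?S) * type_weight (exc_weight {} t) ?S \<sigma>)"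
    by (simp add: D cyc_def exc_def type_weight_exc_weight_empty)
  also have "\<dots> = (\<Sum>\<sigma>\<in>?D. \<beta> ^ card (orbit \<sigma> ` ?S) * type_weight (exc_weight ?S t) ?S \<sigma>)"
    by (simp add: sum_exc_weight)
  also have "\<dots> = (\<Sum>\<sigma>\<in>?D. if \<forall>x\<in>?S. \<not> (x < inv \<sigma> x \<and> \<sigma> x < x) then ?f \<sigma> else 0)"
  proof (rule sum.cong[OF refl])
    fix \<sigma>
    assume "\<sigma> \<in> ?D"
    from type_weight_exc_weight_full[OF finite_atLeastAtMost this, of t]
    show "\<beta> ^ card (orbit \<sigma> ` ?S) * type_weight (exc_weight ?S t) ?S \<sigma> =
        (if \<forall>x\<in>?S. \<not> (x < inv \<sigma> x \<and> \<sigma> x < x) then ?f \<sigma> else 0)"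
      by (simp only: cyc_def V_def card_atLeastAtMost diff_Suc_1 mult_zero_right
          if_distrib[where f = "(*) (\<beta> ^ card (orbit \<sigma> ` ?S))"])
  qed
  also have "\<dots> = sum ?f N"
    unfolding N_def using finD by (simp only: sum.inter_filter)
  also have "\<dots> = (\<Sum>k = 0..n div 2. sum ?f {\<sigma> \<in> N. V \<sigma> = k})"
  proof (rule sum.group[symmetric])
    show "finite N"
      using finD by (simp add: N_def)
    \<comment> \<open>No derangement is lost by the bound on \<open>k\<close>, as twice the valleys
      never exceed \<open>n\<close>.\<close>
    show "V ` N \<subseteq> {0..n div 2}"
      using card_double_ascents[of ?S] by (fastforce simp: N_def V_def)
  qed simp
  also have "\<dots> = (\<Sum>k = 0..n div 2. c_coeff n k \<beta> * t ^ k * (1 + t) ^ (n - 2 * k))"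
    unfolding c_coeff_def val sum_distrib_right by (intro sum.cong) (auto simp: algebra_simps)
  finally show ?thesis .
qed

end
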